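(* The sequential algorithm with the combined early and late delivery scheduling policy is asymptotically $4$-approximate for the container delivery scheduling problem.
   Context: An instance $\langle \mathcal{I},B\rangle$ of the container delivery scheduling problem consists of a set $\mathcal{I}=\{1,\ldots,n\}$ of items, each item $i$ having a due time $d_i\in\mathbb{Z}^+$, and an inventory bound $B>0$. For a time $\tau\ge 0$ put $\delta_i(\tau)=|d_i-\tau|$. A feasible solution with $m$ bins is a partition of $\mathcal{I}$ into subsets (bins) $\mathcal{S}_1,\ldots,\mathcal{S}_m$ together with delivery times $\mu_1,\ldots,\mu_m\ge 0$ such that $\sum_{i\in\mathcal{S}_j}\delta_i(\mu_j)\le B$ for every $j$. An optimal solution is a feasible solution minimizing the number of bins; this minimum is denoted $\hat m$. An algorithm is asymptotically $\rho$-approximate if there is a constant $c$, independent of the instance, such that on every instance it returns a feasible solution with $m\le\rho\,\hat m+c$ bins. Sequential algorithm: number the items so that $d_1\le\ldots\le d_n$. Open an empty bin $j=1$. For $i=1,\ldots,n$ in this order: if the inventory cost of the set $\mathcal{S}_j\cup\{i\}$, when delivered in one bin (with index $j$) at the time prescribed by the scheduling policy, exceeds $B$, then open a new empty bin and let $j$ be its index ($j\leftarrow j+1$); in either case, add $i$ to $\mathcal{S}_j$. At the end each bin is delivered at the time prescribed by the policy. Combined early and late delivery scheduling policy: a set $\mathcal{S}_j$ of items packed in bin $j$ is delivered at $\mu_j=\min_{i\in\mathcal{S}_j}d_i$ if $j$ is odd, and at $\mu_j=\max_{i\in\mathcal{S}_j}d_i$ if $j$ is even. *)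

theory Defs
  imports "HOL-Analysis.Analysis"
begin

(* The item set is {1..num_items}; due and inv_bound are d and B. *)
record cds_instance =
  num_items :: nat
  due :: "nat \<Rightarrow> nat"
  inv_bound :: real

definition items :: "cds_instance \<Rightarrow> nat set" where
  "items I = {1..num_items I}"

definition valid_instance :: "cds_instance \<Rightarrow> bool" where
  "valid_instance I \<longleftrightarrow>
     num_items I \<ge> 1 \<and> (\<forall>i\<in>items I. due I i > 0) \<and> inv_bound I > 0"

definition deviation :: "cds_instance \<Rightarrow> nat \<Rightarrow> real \<Rightarrow> real" where
  "deviation I i t = \<bar>real (due I i) - t\<bar>"

definition inventory_cost :: "cds_instance \<Rightarrow> nat set \<Rightarrow> real \<Rightarrow> real" where
  "inventory_cost I S t = (\<Sum>i\<in>S. deviation I i t)"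

(* Bins are indexed by 1, ..., num_bins; bin and delivery are irrelevant at other indices. *)
record cds_solution =
  num_bins :: nat
  bin :: "nat \<Rightarrow> nat set"
  delivery :: "nat \<Rightarrow> real"

definition feasible :: "cds_instance \<Rightarrow> cds_solution \<Rightarrow> bool" where
  "feasible I s \<longleftrightarrow>
     (\<Union>j\<in>{1..num_bins s}. bin s j) = items I \<and>
     disjoint_family_on (bin s) {1..num_bins s} \<and>
     (\<forall>j\<in>{1..num_bins s}.
        bin s j \<noteq> {} \<and> delivery s j \<ge> 0 \<and>
        inventory_cost I (bin s j) (delivery s j) \<le> inv_bound I)"

definition opt_bins :: "cds_instance \<Rightarrow> nat" where
  "opt_bins I = (LEAST m. \<exists>s. feasible I s \<and> num_bins s = m)"

(* An algorithm relates an instance to its possible outputs. It may have several because ties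
   between equal due times can be broken arbitrarily; the guarantee is for each of them. *)
type_synonym cds_algorithm = "cds_instance \<Rightarrow> cds_solution \<Rightarrow> bool"

definition asymptotically_approximate :: "real \<Rightarrow> cds_algorithm \<Rightarrow> bool" where
  "asymptotically_approximate \<rho> alg \<longleftrightarrow>
     (\<exists>c::real. \<forall>I. valid_instance I \<longrightarrow>
        (\<exists>s. alg I s) \<and>
        (\<forall>s. alg I s \<longrightarrow>
           feasible I s \<and> real (num_bins s) \<le> \<rho> * real (opt_bins I) + c))"

(* A policy maps a bin index and the contents of that bin to a delivery time. *)
type_synonym cds_policy = "cds_instance \<Rightarrow> nat \<Rightarrow> nat set \<Rightarrow> real"

definition combined_policy :: cds_policy where
  "combined_policy I j S =
     (if odd j then real (Min (due I ` S)) else real (Max (due I ` S)))"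

(* The state consists of the index of the open bin and the contents of all bins. *)
definition seq_step ::
    "cds_policy \<Rightarrow> cds_instance \<Rightarrow> nat \<Rightarrow> nat \<times> (nat \<Rightarrow> nat set) \<Rightarrow> nat \<times> (nat \<Rightarrow> nat set)" where
  "seq_step P I i = (\<lambda>(j, S).
     let S' = insert i (S j);
         j' = (if inventory_cost I S' (P I j S') > inv_bound I then j + 1 else j)
     in (j', S(j' := insert i (S j'))))"

(* The list xs is a numbering of the items in nondecreasing order of due time. *)
definition sequential_algorithm :: "cds_policy \<Rightarrow> cds_algorithm" where
  "sequential_algorithm P I s \<longleftrightarrow>
     (\<exists>xs m S. distinct xs \<and> set xs = items I \<and> sorted (map (due I) xs) \<and>
        (m, S) = fold (seq_step P I) xs (1, \<lambda>_. {}) \<and>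
        s = \<lparr>num_bins = m, bin = S, delivery = (\<lambda>j. P I j (S j))\<rparr>)"

end

theory Submission
  imports Defs
begin

text \<open>
  Number the bins of the algorithm from 1 and group them into blocks consisting of an early bin
  \<open>E\<close> and the late bin \<open>L\<close> after it. Let \<open>a\<close> be the first due time of a block and \<open>b\<close> the first
  due time of the next block. As neither bin could take the first item after it, the items of \<open>E\<close>
  together with the first item \<open>x\<close> of \<open>L\<close> cost more than \<open>B\<close> when delivered at \<open>a\<close>, and those of \<open>L\<close>
  cost more than \<open>B\<close> when delivered at \<open>b\<close>. Consider an optimal solution with \<open>q\<close> bins. If it makes
  no delivery strictly between \<open>a\<close> and \<open>b\<close>, then each item of the block costs it at least the
  distance to the nearer of \<open>a\<close> and \<open>b\<close>; hence the block costs at least \<open>B\<close>, because of \<open>E\<close> and \<open>x\<close>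
  if \<open>x\<close> is nearer to \<open>a\<close>, and because of \<open>L\<close> otherwise. So there are at most \<open>q\<close> blocks of this kind,
  and at most \<open>q\<close> others since the open intervals are disjoint. Every block has two bins.
\<close>

section \<open>Invariant of the sequential algorithm\<close>

text \<open>Describes the state after the items of \<open>X\<close> have been read. The guard
  \<open>X \<noteq> {}\<close> is due to the initial state, in which bin 1 is open and empty. The
  last clause records why a bin was closed; its witness is the item that opened the next bin,
  recognised by its minimal due time.\<close>

definition sequential_packing ::
    "cds_policy \<Rightarrow> cds_instance \<Rightarrow> nat set \<Rightarrow> nat \<Rightarrow> (nat \<Rightarrow> nat set) \<Rightarrow> bool" where
  "sequential_packing P I X m S \<longleftrightarrow>
     m \<ge> 1 \<and> (\<Union>j\<in>{1..m}. S j) = X \<and> (\<forall>j>m. S j = {}) \<and>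
     (X \<noteq> {} \<longrightarrow> (\<forall>j\<in>{1..m}. S j \<noteq> {})) \<and>
     (\<forall>i\<in>{1..m}. \<forall>j\<in>{1..m}. i < j \<longrightarrow> S i \<inter> S j = {} \<and> (\<forall>x\<in>S i. \<forall>y\<in>S j. due I x \<le> due I y)) \<and>
     (\<forall>j\<in>{1..m}. S j \<noteq> {} \<longrightarrow> inventory_cost I (S j) (P I j (S j)) \<le> inv_bound I) \<and>
     (\<forall>j\<in>{1..<m}. \<exists>x\<in>S (Suc j). (\<forall>y\<in>S (Suc j). due I x \<le> due I y) \<and>
        inventory_cost I (insert x (S j)) (P I j (insert x (S j))) > inv_bound I)"

lemma sequential_packing_step:
  assumes pack: "sequential_packing P I X m S"
    and single: "\<And>j x. P I j {x} = real (due I x)" and B: "inv_bound I \<ge> 0"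
    and x: "x \<notin> X" "\<And>y. y \<in> X \<Longrightarrow> due I y \<le> due I x"
    and step: "(m', S') = seq_step P I x (m, S)"
  shows "sequential_packing P I (insert x X) m' S'"
proof -
  have m: "m \<ge> 1" and UN: "(\<Union>j\<in>{1..m}. S j) = X" and empty: "\<And>j. j > m \<Longrightarrow> S j = {}"
    and ne: "X \<noteq> {} \<Longrightarrow> \<forall>j\<in>{1..m}. S j \<noteq> {}"
    and order: "\<And>i j. i \<in> {1..m} \<Longrightarrow> j \<in> {1..m} \<Longrightarrow> i < j \<Longrightarrow>
      S i \<inter> S j = {} \<and> (\<forall>x\<in>S i. \<forall>y\<in>S j. due I x \<le> due I y)"
    and cost: "\<And>j. j \<in> {1..m} \<Longrightarrow> S j \<noteq> {} \<Longrightarrow>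
      inventory_cost I (S j) (P I j (S j)) \<le> inv_bound I"
    and over: "\<And>j. j \<in> {1..<m} \<Longrightarrow> \<exists>x\<in>S (Suc j). (\<forall>y\<in>S (Suc j). due I x \<le> due I y) \<and>
      inventory_cost I (insert x (S j)) (P I j (insert x (S j))) > inv_bound I"
    using pack unfolding sequential_packing_def by blast+
  have sub: "S j \<subseteq> X" if "j \<in> {1..m}" for j using UN that by blast
  have single_cost: "inventory_cost I {x} (P I j {x}) = 0" for j
    by (simp add: inventory_cost_def deviation_def single)
  \<comment> \<open>Hence the very first item goes into bin 1 and leaves no empty bin
    behind.\<close>
  have m_if_empty: "m = 1" if "X = {}"
  proof (rule ccontr)
    assume "m \<noteq> 1"
    then have "1 \<in> {1..<m}" "Suc 1 \<in> {1..m}" using m by auto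
    then show False using over[of 1] sub[of "Suc 1"] that by blast
  qed
  let ?T = "insert x (S m)"
  show ?thesis
  proof (cases "inventory_cost I ?T (P I m ?T) > inv_bound I")
    case True
    then have m': "m' = Suc m" and S': "S' = S(Suc m := {x})"
      using step empty[of "Suc m"] by (auto simp: seq_step_def Let_def)
    \<comment> \<open>A lone item costs nothing, so an empty open bin cannot overflow and no empty
      bin is ever closed.\<close>
    have Sm: "S m \<noteq> {}" using True single_cost[of m] B by auto
    then have X: "X \<noteq> {}" using sub[of m] m by auto
    have range: "{1..Suc m} = insert (Suc m) {1..m}" by auto
    have range': "{1..<Suc m} = insert m {1..<m}" using m by auto
    have UN': "(\<Union>j\<in>{1..Suc m}. S' j) = insert x X"
      using UN unfolding range S' by auto
    have order': "S' i \<inter> S' j = {} \<and> (\<forall>x\<in>S' i. \<forall>y\<in>S' j. due I x \<le> due I y)"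
      if "i \<in> {1..Suc m}" "j \<in> {1..Suc m}" "i < j" for i j
    proof (cases "j = Suc m")
      case True
      then have "i \<in> {1..m}" using that by auto
      then show ?thesis using sub[of i] x True by (auto simp: S')
    next
      case False
      then show ?thesis using order[of i j] that by (auto simp: S')
    qed
    have over': "\<exists>x\<in>S' (Suc j). (\<forall>y\<in>S' (Suc j). due I x \<le> due I y) \<and>
        inventory_cost I (insert x (S' j)) (P I j (insert x (S' j))) > inv_bound I"
      if "j \<in> {1..<Suc m}" for j
    proof (cases "j = m")
      case False
      then have "j \<in> {1..<m}" using that by auto
      then show ?thesis using over[of j] by (simp add: S')
    qed (use True in \<open>simp add: S'\<close>)
    have "\<forall>j\<in>{1..Suc m}. S' j \<noteq> {}" using ne[OF X] unfolding range S' by auto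
    moreover have "inventory_cost I (S' j) (P I j (S' j)) \<le> inv_bound I" if "j \<in> {1..Suc m}" for j
    proof (cases "j = Suc m")
      case False
      then show ?thesis using cost[of j] ne[OF X] that by (simp add: S')
    qed (use single_cost B in \<open>simp add: S'\<close>)
    moreover have "S' j = {}" if "j > Suc m" for j using empty[of j] that by (simp add: S')
    moreover have "Suc m \<ge> 1" by simp
    ultimately show ?thesis
      using UN' order' over' unfolding sequential_packing_def m' by (intro conjI) blast+
  next
    case False
    then have m': "m' = m" and S': "S' = S(m := ?T)"
      using step by (auto simp: seq_step_def Let_def)
    have mm: "m \<in> {1..m}" using m by auto
    have UN': "(\<Union>j\<in>{1..m}. S' j) = insert x X"
      using UN mm unfolding S' by (auto split: if_splits)
    have ne': "S' j \<noteq> {}" if "j \<in> {1..m}" for j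
      using ne m_if_empty that by (cases "X = {}") (auto simp: S')
    have order': "S' i \<inter> S' j = {} \<and> (\<forall>x\<in>S' i. \<forall>y\<in>S' j. due I x \<le> due I y)"
      if "i \<in> {1..m}" "j \<in> {1..m}" "i < j" for i j
      using order[OF that] sub[of i] that x by (auto simp: S')
    have over': "\<exists>x\<in>S' (Suc j). (\<forall>y\<in>S' (Suc j). due I x \<le> due I y) \<and>
        inventory_cost I (insert x (S' j)) (P I j (insert x (S' j))) > inv_bound I"
      if j: "j \<in> {1..<m}" for j
    \<comment> \<open>The old witness remains minimal even if \<open>x\<close> joins its bin, since
      \<open>x\<close> is due no earlier.\<close>
    proof -
      obtain z where z: "z \<in> S (Suc j)" "\<forall>y\<in>S (Suc j). due I z \<le> due I y"
        "inventory_cost I (insert z (S j)) (P I j (insert z (S j))) > inv_bound I"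
        using over[OF j] by blast
      have "z \<in> X" using sub[of "Suc j"] z(1) j by auto
      then have "due I z \<le> due I x" using x by blast
      then show ?thesis using z j by (intro bexI[of _ z]) (auto simp: S')
    qed
    have cost': "inventory_cost I (S' j) (P I j (S' j)) \<le> inv_bound I"
      if "j \<in> {1..m}" "S' j \<noteq> {}" for j
      using cost[of j] that False by (cases "j = m") (auto simp: S')
    have "S' j = {}" if "j > m" for j using empty[of j] that by (simp add: S')
    then show ?thesis
      using m UN' ne' order' over' cost' unfolding sequential_packing_def m'
      by (intro conjI) blast+
  qed
qed

lemma sequential_packing_fold:
  assumes single: "\<And>j x. P I j {x} = real (due I x)" and B: "inv_bound I \<ge> 0"
    and "distinct xs" "sorted (map (due I) xs)"
    and "(m, S) = fold (seq_step P I) xs (1, \<lambda>_. {})"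
  shows "sequential_packing P I (set xs) m S"
  using assms(3-5)
proof (induction xs arbitrary: m S rule: rev_induct)
  case Nil
  then show ?case by (auto simp: sequential_packing_def)
next
  case (snoc x xs)
  obtain m0 S0 where prev: "(m0, S0) = fold (seq_step P I) xs (1, \<lambda>_. {})"
    by (metis surj_pair)
  then have "sequential_packing P I (set xs) m0 S0"
    using snoc by (simp add: sorted_append)
  then have "sequential_packing P I (insert x (set xs)) m S"
    by (rule sequential_packing_step) (use single B snoc.prems prev in \<open>auto simp: sorted_append\<close>)
  then show ?case by simp
qed

section \<open>Lower bounds on the cost of an arbitrary solution\<close>

text \<open>Along increasing due times the distance to \<open>a\<close> grows and the distance to
  \<open>b\<close> shrinks. So \<open>x\<close>, which separates \<open>E\<close> from
  \<open>L\<close>, decides for a whole set at once: either all of \<open>insert x E\<close> is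
  nearer to \<open>a\<close>, or all of \<open>L\<close> is nearer to \<open>b\<close>.\<close>

lemma block_cost:
  fixes c d :: "'a \<Rightarrow> real"
  assumes "finite E" "finite L" "E \<inter> L = {}" "x \<in> L"
    and E: "\<And>i. i \<in> E \<Longrightarrow> a \<le> d i \<and> d i \<le> d x"
    and L: "\<And>i. i \<in> L \<Longrightarrow> d x \<le> d i \<and> d i \<le> b"
    and over_E: "B \<le> (\<Sum>i\<in>insert x E. d i - a)" and over_L: "B \<le> (\<Sum>i\<in>L. b - d i)"
    and c: "\<And>i. i \<in> E \<union> L \<Longrightarrow> 0 \<le> c i \<and> min (d i - a) (b - d i) \<le> c i"
  shows "B \<le> (\<Sum>i\<in>E \<union> L. c i)"
proof (cases "d x - a \<le> b - d x")
  case True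
  have "B \<le> (\<Sum>i\<in>insert x E. c i)"
  proof (rule order.trans[OF over_E], rule sum_mono)
    fix i assume "i \<in> insert x E"
    then have "i \<in> E \<union> L" "d i \<le> d x" using E \<open>x \<in> L\<close> by auto
    then show "d i - a \<le> c i" using c[of i] True by (simp add: min_def split: if_splits)
  qed
  also have "\<dots> \<le> (\<Sum>i\<in>E \<union> L. c i)"
    using assms by (intro sum_mono2) auto
  finally show ?thesis .
next
  case False
  have "B \<le> (\<Sum>i\<in>L. c i)"
  proof (rule order.trans[OF over_L], rule sum_mono)
    fix i assume "i \<in> L"
    then show "b - d i \<le> c i" using c[of i] L[of i] False by (simp add: min_def split: if_splits)
  qed
  also have "\<dots> \<le> (\<Sum>i\<in>E \<union> L. c i)"
    using assms by (intro sum_mono2) auto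
  finally show ?thesis .
qed

text \<open>Splits the cost of a solution into costs of single items, because the blocks of the
  algorithm may cut across the bins of \<open>s\<close>. Disjointness of the bins makes
  \<open>f i\<close> the unique bin of item \<open>i\<close>.\<close>

lemma feasible_item_costs:
  assumes "feasible I s"
  obtains c where "\<And>i. c i \<ge> 0"
    and "\<And>i. i \<in> items I \<Longrightarrow> \<exists>j\<in>{1..num_bins s}. c i = deviation I i (delivery s j)"
    and "(\<Sum>i\<in>items I. c i) \<le> real (num_bins s) * inv_bound I"
proof -
  let ?J = "{1..num_bins s}"
  have UN: "(\<Union>j\<in>?J. bin s j) = items I" and disj: "disjoint_family_on (bin s) ?J"
    and le: "\<And>j. j \<in> ?J \<Longrightarrow> inventory_cost I (bin s j) (delivery s j) \<le> inv_bound I"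
    using assms by (auto simp: feasible_def)
  define f where "f i = (SOME j. j \<in> ?J \<and> i \<in> bin s j)" for i
  define c where "c i = deviation I i (delivery s (f i))" for i
  have f: "f i \<in> ?J \<and> i \<in> bin s (f i)" if "i \<in> items I" for i
  proof -
    have "\<exists>j. j \<in> ?J \<and> i \<in> bin s j" using UN that by blast
    then show ?thesis unfolding f_def by (rule someI_ex)
  qed
  have f_eq: "f i = j" if "j \<in> ?J" "i \<in> bin s j" for i j
  proof -
    have "f i \<in> ?J \<and> i \<in> bin s (f i)" using f that UN by blast
    then show ?thesis using disj that unfolding disjoint_family_on_def by blast
  qed
  have fin: "finite (bin s j)" if "j \<in> ?J" for j
    by (rule finite_subset[of _ "items I"]) (use UN that in \<open>auto simp: items_def\<close>)
  have "(\<Sum>i\<in>items I. c i) = (\<Sum>j\<in>?J. \<Sum>i\<in>bin s j. c i)"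
    unfolding UN[symmetric] using fin disj
    by (intro sum.UNION_disjoint) (auto simp: disjoint_family_on_def)
  also have "\<dots> = (\<Sum>j\<in>?J. inventory_cost I (bin s j) (delivery s j))"
    by (intro sum.cong refl) (simp add: c_def f_eq inventory_cost_def)
  also have "\<dots> \<le> (\<Sum>j\<in>?J. inv_bound I)" by (intro sum_mono le)
  finally have "(\<Sum>i\<in>items I. c i) \<le> real (num_bins s) * inv_bound I" by simp
  then show ?thesis
    using f by (intro that[of c]) (auto simp: c_def deviation_def)
qed

text \<open>A block with a delivery strictly inside its interval is charged to that delivery; the
  other blocks draw at least \<open>B\<close> each from the total budget
  \<open>q * B\<close>.\<close>

lemma card_blocks_le:
  fixes a :: "nat \<Rightarrow> real" and t :: "nat \<Rightarrow> real" and c :: "'a \<Rightarrow> real"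
  assumes a: "\<And>k l. k \<le> l \<Longrightarrow> l \<le> K \<Longrightarrow> a k \<le> a l"
    and "finite X" and nonneg: "\<And>i. c i \<ge> 0" and total: "(\<Sum>i\<in>X. c i) \<le> real q * B" and "B > 0"
    and U: "\<And>k. k < K \<Longrightarrow> U k \<subseteq> X" "disjoint_family_on U {..<K}"
    and cost: "\<And>k. k < K \<Longrightarrow> (\<And>j. j \<in> {1..q} \<Longrightarrow> t j \<notin> {a k<..<a (Suc k)}) \<Longrightarrow> B \<le> (\<Sum>i\<in>U k. c i)"
  shows "K \<le> 2 * q"
proof -
  define M where "M = {k\<in>{..<K}. \<exists>j\<in>{1..q}. t j \<in> {a k<..<a (Suc k)}}"
  have "\<forall>k\<in>M. \<exists>j. j \<in> {1..q} \<and> t j \<in> {a k<..<a (Suc k)}"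
    unfolding M_def by blast
  then obtain g where g: "\<And>k. k \<in> M \<Longrightarrow> g k \<in> {1..q} \<and> t (g k) \<in> {a k<..<a (Suc k)}"
    by (metis (no_types, lifting) bchoice)
  have neq: "g k \<noteq> g l" if "k \<in> M" "l \<in> M" "k < l" for k l
  proof
    assume "g k = g l"
    \<comment> \<open>The common delivery would lie after \<open>a l\<close> and before
      \<open>a (Suc k)\<close>.\<close>
    then have "a l < a (Suc k)" using g[of k] g[of l] that by auto
    moreover have "a (Suc k) \<le> a l" using a[of "Suc k" l] that by (auto simp: M_def)
    ultimately show False by simp
  qed
  have "inj_on g M" by (rule linorder_inj_onI) (use neq in auto)
  then have "card M \<le> card {1..q}" using g by (intro card_inj_on_le) auto
  then have M: "card M \<le> q" by simp
  let ?N = "{..<K} - M"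
  have "real (card ?N) * B = (\<Sum>k\<in>?N. B)" by simp
  also have "\<dots> \<le> (\<Sum>k\<in>?N. \<Sum>i\<in>U k. c i)" by (intro sum_mono cost) (auto simp: M_def)
  also have "\<dots> = (\<Sum>i\<in>(\<Union>k\<in>?N. U k). c i)"
    using U \<open>finite X\<close> by (intro sum.UNION_disjoint[symmetric])
      (auto simp: disjoint_family_on_def intro: finite_subset)
  also have "\<dots> \<le> (\<Sum>i\<in>X. c i)" using U nonneg \<open>finite X\<close> by (intro sum_mono2) auto
  also note total
  finally have "card ?N \<le> q" using \<open>B > 0\<close> by simp
  moreover have "card ?N = K - card M" by (subst card_Diff_subset) (auto simp: M_def)
  ultimately show ?thesis using M by simp
qed

section \<open>Counting the bins of the combined policy\<close>

lemma combined_packing_bins_le: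
  assumes pack: "sequential_packing combined_policy I (items I) m S"
    and ne: "items I \<noteq> {}" and B: "inv_bound I > 0" and feas: "feasible I s"
  shows "m \<le> 4 * num_bins s + 2"
proof -
  \<comment> \<open>Only pairs of bins followed by a further bin count as blocks, since the bound
    for the late bin needs the item that overflowed it. At most two bins are left over, which gives
    the additive 2.\<close>
  define K where "K = (m - 1) div 2"
  define a where "a k = real (Min (due I ` S (2*k+1)))" for k
  define U where "U k = S (2*k+1) \<union> S (2*k+2)" for k
  have m: "m \<ge> 1" and UN: "(\<Union>j\<in>{1..m}. S j) = items I"
    and S_ne: "\<And>j. j \<in> {1..m} \<Longrightarrow> S j \<noteq> {}"
    and disj: "\<And>i j. i \<in> {1..m} \<Longrightarrow> j \<in> {1..m} \<Longrightarrow> i < j \<Longrightarrow> S i \<inter> S j = {}"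
    and order: "\<And>i j x y. i \<in> {1..m} \<Longrightarrow> j \<in> {1..m} \<Longrightarrow> i < j \<Longrightarrow> x \<in> S i \<Longrightarrow> y \<in> S j \<Longrightarrow>
      due I x \<le> due I y"
    and over: "\<And>j. j \<in> {1..<m} \<Longrightarrow> \<exists>x\<in>S (Suc j). (\<forall>y\<in>S (Suc j). due I x \<le> due I y) \<and>
      inventory_cost I (insert x (S j)) (combined_policy I j (insert x (S j))) > inv_bound I"
    using pack ne unfolding sequential_packing_def by blast+
  have disj': "S i \<inter> S j = {}" if "i \<in> {1..m}" "j \<in> {1..m}" "i \<noteq> j" for i j
    using disj[of i j] disj[of j i] that by (cases "i < j") auto
  have sub: "S j \<subseteq> items I" if "j \<in> {1..m}" for j using UN that by blast
  have fin: "finite (S j)" if "j \<in> {1..m}" for j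
    using sub[OF that] by (rule finite_subset) (simp add: items_def)
  have K: "2 * k + 3 \<le> m" if "k < K" for k using that by (auto simp: K_def)
  have K': "2 * k + 1 \<in> {1..m}" if "k \<le> K" for k using that m by (auto simp: K_def)
  have a_le: "a k \<le> due I i" if "i \<in> S (2*k+1)" "k \<le> K" for i k
    using that fin[OF K'[OF that(2)]] by (auto simp: a_def)
  have a_attained: "\<exists>i\<in>S (2*k+1). a k = due I i" if "k \<le> K" for k
  proof -
    have "Min (due I ` S (2*k+1)) \<in> due I ` S (2*k+1)"
      using fin[OF K'[OF that]] S_ne[OF K'[OF that]] by (intro Min_in) auto
    then show ?thesis by (auto simp: a_def)
  qed
  have a_mono: "a k \<le> a l" if kl: "k \<le> l" "l \<le> K" for k l
  proof (cases "k = l")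
    case False
    then have "k < l" using kl by simp
    obtain i where i: "i \<in> S (2*l+1)" "a l = due I i" using a_attained[OF kl(2)] by blast
    obtain h where h: "h \<in> S (2*k+1)" "a k = due I h" using a_attained[of k] kl by auto
    show ?thesis using order[OF K'[of k] K'[of l] _ h(1) i(1)] h i kl \<open>k < l\<close> by simp
  qed simp
  have U_sub: "U k \<subseteq> items I" if "k < K" for k
    using sub[of "2*k+1"] sub[of "2*k+2"] K[OF that] unfolding U_def by auto
  have U_disj: "disjoint_family_on U {..<K}"
    unfolding disjoint_family_on_def
  proof (intro ballI impI)
    fix k l assume kl: "k \<in> {..<K}" "l \<in> {..<K}" "k \<noteq> l"
    have "S i \<inter> S j = {}" if "i \<in> {2*k+1, 2*k+2}" "j \<in> {2*l+1, 2*l+2}" for i j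
    proof (rule disj')
      show "i \<in> {1..m}" "j \<in> {1..m}" using K[of k] K[of l] kl that by auto
      \<comment> \<open>The index of a bin determines its block.\<close>
      have "k = (i - 1) div 2" "l = (j - 1) div 2" using that by auto
      then show "i \<noteq> j" using kl by blast
    qed
    then show "U k \<inter> U l = {}" unfolding U_def by blast
  qed
  obtain c where c_nonneg: "\<And>i. c i \<ge> 0"
    and c: "\<And>i. i \<in> items I \<Longrightarrow> \<exists>j\<in>{1..num_bins s}. c i = deviation I i (delivery s j)"
    and c_total: "(\<Sum>i\<in>items I. c i) \<le> real (num_bins s) * inv_bound I"
    using feasible_item_costs[OF feas] by metis
  have "K \<le> 2 * num_bins s"
  proof (rule card_blocks_le[OF a_mono _ c_nonneg c_total B U_sub U_disj])
    show "finite (items I)" by (simp add: items_def)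
    fix k assume k: "k < K"
      and gap: "\<And>j. j \<in> {1..num_bins s} \<Longrightarrow> delivery s j \<notin> {a k<..<a (Suc k)}"
    let ?E = "S (2*k+1)" and ?L = "S (2*k+2)" and ?N = "S (2*k+3)"
    have idx: "2*k+1 \<in> {1..m}" "2*k+2 \<in> {1..m}" "2*k+3 \<in> {1..m}" using K[OF k] by auto
    have fE: "finite ?E" and fL: "finite ?L" using fin idx by blast+
    obtain e where e: "e \<in> ?E" "a k = due I e" using a_attained[of k] k by auto
    have next_block: "2 * Suc k + 1 = 2*k+3" by simp
    obtain n where n: "n \<in> ?N" "a (Suc k) = due I n"
      using a_attained[of "Suc k"] k unfolding next_block by auto
    have n_min: "due I n \<le> due I y" if "y \<in> ?N" for y
      using a_le[of y "Suc k"] n that k unfolding next_block by simp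
    have Suc: "Suc (2*k+1) = 2*k+2" "Suc (2*k+2) = 2*k+3" by simp_all
    have lt: "2*k+1 \<in> {1..<m}" "2*k+2 \<in> {1..<m}" using K[OF k] by auto
    obtain x where x: "x \<in> ?L" "\<forall>y\<in>?L. due I x \<le> due I y"
      "inventory_cost I (insert x ?E) (combined_policy I (2*k+1) (insert x ?E)) > inv_bound I"
      using over[OF lt(1)] unfolding Suc by blast
    obtain y where y: "y \<in> ?N" "\<forall>z\<in>?N. due I y \<le> due I z"
      "inventory_cost I (insert y ?L) (combined_policy I (2*k+2) (insert y ?L)) > inv_bound I"
      using over[OF lt(2)] unfolding Suc by blast
    have EL: "due I u \<le> due I v" if "u \<in> ?E" "v \<in> ?L" for u v
      using order[OF idx(1,2) _ that] by simp
    have LN: "due I u \<le> due I v" if "u \<in> ?L" "v \<in> ?N" for u v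
      using order[OF idx(2,3) _ that] by simp
    \<comment> \<open>\<open>y\<close> and \<open>n\<close> may be different items, but both have
      the least due time in the bin.\<close>
    have yn: "due I y = due I n" using y n n_min by (intro antisym) auto
    have e_min: "due I e \<le> due I i" if "i \<in> ?E" for i using a_le[OF that] e k by simp
    \<comment> \<open>Adding the later item \<open>x\<close> leaves the early delivery time at
      \<open>a k\<close>.\<close>
    have "Min (due I ` insert x ?E) = due I e"
      using fE e e_min EL[OF e(1) x(1)] by (intro Min_eqI) auto
    then have "inventory_cost I (insert x ?E) (combined_policy I (2*k+1) (insert x ?E))
        = (\<Sum>i\<in>insert x ?E. due I i - a k)"
      unfolding inventory_cost_def combined_policy_def deviation_def e
      by (intro sum.cong) (use e_min EL[OF e(1) x(1)] in auto)
    then have over_E: "inv_bound I \<le> (\<Sum>i\<in>insert x ?E. due I i - a k)" using x by simp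
    have "y \<notin> ?L" using disj[OF idx(2,3)] y by auto
    \<comment> \<open>Adding \<open>y\<close> moves the late delivery time to
      \<open>a (Suc k)\<close>. There \<open>y\<close> itself costs nothing, so the excess over the
      bound is borne by \<open>?L\<close> alone.\<close>
    have "Max (due I ` insert y ?L) = due I n"
      using fL LN[OF _ y(1)] yn by (intro Max_eqI) auto
    then have "inventory_cost I (insert y ?L) (combined_policy I (2*k+2) (insert y ?L))
        = (\<Sum>i\<in>insert y ?L. a (Suc k) - due I i)"
      unfolding inventory_cost_def combined_policy_def deviation_def n
      by (intro sum.cong) (use yn LN[OF _ y(1)] in auto)
    also have "\<dots> = (\<Sum>i\<in>?L. a (Suc k) - due I i)"
      using fL \<open>y \<notin> ?L\<close> yn n by simp
    finally have over_L: "inv_bound I \<le> (\<Sum>i\<in>?L. a (Suc k) - due I i)" using y by simp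
    show "inv_bound I \<le> (\<Sum>i\<in>U k. c i)"
      unfolding U_def
    proof (rule block_cost[OF fE fL _ x(1) _ _ over_E over_L])
      show "?E \<inter> ?L = {}" using disj[OF idx(1,2)] by simp
      show "a k \<le> real (due I i) \<and> real (due I i) \<le> real (due I x)" if "i \<in> ?E" for i
        using e e_min[OF that] EL[OF that x(1)] by simp
      show "real (due I x) \<le> real (due I i) \<and> real (due I i) \<le> a (Suc k)" if "i \<in> ?L" for i
        using x that LN[OF that n(1)] n by simp
      show "0 \<le> c i \<and> min (real (due I i) - a k) (a (Suc k) - real (due I i)) \<le> c i"
        if "i \<in> ?E \<union> ?L" for i
      proof -
        have "i \<in> items I" using that sub idx by blast
        then obtain j where j: "j \<in> {1..num_bins s}" "c i = deviation I i (delivery s j)"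
          using c by blast
        \<comment> \<open>A delivery up to \<open>a k\<close> is at least as far from item
          \<open>i\<close> as \<open>a k\<close> is if \<open>i\<close> is due after
          \<open>a k\<close>, and symmetrically for \<open>a (Suc k)\<close>.\<close>
        show ?thesis using gap[OF j(1)] j(2) by (auto simp: deviation_def)
      qed
    qed
  qed
  then show ?thesis unfolding K_def by linarith
qed

section \<open>Feasibility, existence of outputs and the guarantee\<close>

lemma sequential_packing_feasible:
  assumes pack: "sequential_packing P I (items I) m S" and ne: "items I \<noteq> {}"
    and nonneg: "\<And>j. j \<in> {1..m} \<Longrightarrow> P I j (S j) \<ge> 0"
  shows "feasible I \<lparr>num_bins = m, bin = S, delivery = (\<lambda>j. P I j (S j))\<rparr>"
proof -
  have disj: "S i \<inter> S j = {}" if "i \<in> {1..m}" "j \<in> {1..m}" "i < j" for i j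
    using pack that unfolding sequential_packing_def by blast
  have "disjoint_family_on S {1..m}"
    unfolding disjoint_family_on_def by (metis disj inf_commute nat_neq_iff)
  then show ?thesis
    using pack ne nonneg unfolding sequential_packing_def feasible_def by simp
qed

lemma sequential_algorithm_total: "\<exists>s. sequential_algorithm P I s"
proof -
  let ?xs = "sort_key (due I) [1..<Suc (num_items I)]"
  have "distinct ?xs" "set ?xs = items I" "sorted (map (due I) ?xs)"
    by (auto simp: items_def)
  then show ?thesis unfolding sequential_algorithm_def by (metis surj_pair)
qed

lemma feasible_opt:
  assumes "feasible I s"
  obtains s' where "feasible I s'" "num_bins s' = opt_bins I"
proof -
  have "\<exists>s'. feasible I s' \<and> num_bins s' = opt_bins I"
    unfolding opt_bins_def by (rule LeastI_ex) (use assms in blast)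
  then show ?thesis using that by blast
qed

theorem theorem5:
  shows "asymptotically_approximate 4 (sequential_algorithm combined_policy)"
  unfolding asymptotically_approximate_def
proof (rule exI[of _ 2], intro allI impI conjI)
  fix I assume "valid_instance I"
  then have ne: "items I \<noteq> {}" and B: "inv_bound I > 0"
    by (auto simp: valid_instance_def items_def)
  show "\<exists>s. sequential_algorithm combined_policy I s" by (rule sequential_algorithm_total)
  fix s assume "sequential_algorithm combined_policy I s"
  then obtain xs m S where xs: "distinct xs" "set xs = items I" "sorted (map (due I) xs)"
    and run: "(m, S) = fold (seq_step combined_policy I) xs (1, \<lambda>_. {})"
    and s: "s = \<lparr>num_bins = m, bin = S, delivery = (\<lambda>j. combined_policy I j (S j))\<rparr>"
    unfolding sequential_algorithm_def by blast
  \<comment> \<open>For a singleton the minimum and the maximum agree, so both parities deliver it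
    at its own due time.\<close>
  have pack: "sequential_packing combined_policy I (items I) m S"
    using sequential_packing_fold[OF _ _ xs(1,3) run] B xs(2) by (simp add: combined_policy_def)
  show feas: "feasible I s"
    unfolding s by (rule sequential_packing_feasible[OF pack ne]) (simp add: combined_policy_def)
  obtain s' where "feasible I s'" "num_bins s' = opt_bins I" using feasible_opt[OF feas] .
  then have "m \<le> 4 * opt_bins I + 2" using combined_packing_bins_le[OF pack ne B] by metis
  then show "real (num_bins s) \<le> 4 * real (opt_bins I) + 2" unfolding s by simp
qed

end
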